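(* Let $p$ be an odd prime. For $n\ge1$ and $1\le b\le p-1$, $$\widehat{P}^{\,(b+1)p_{n-1}-(n-1)}\left((x_1x_2\cdots x_{n-1})^{p-1}x_n^b\right)=w(n)^b\cdot w(n-1)^{p-b-1}$$ in $\mathbb{F}_p[x_1,\dots,x_n]$.
   Context: ${\bf P}=\mathbb{F}_p[x_1,\dots,x_n]$ is graded with each $x_i$ in degree $1$. $\mathcal{A}_p$ is the algebra of Steenrod $p$th powers (mod $p$ Steenrod algebra without Bocksteins), generated by $P^r$, $r\ge0$, $P^0=1$. It acts on ${\bf P}$ on the left by linear maps: $P^1x_i=x_i^p$, $P^rx_i=0$ for $r>1$, $P^r1=0$ for $r>0$, with Cartan formula $P^r(fg)=\sum_{s+t=r}P^sf\cdot P^tg$. The canonical anti-automorphism $\chi$ of $\mathcal{A}_p$ is determined by $\chi(1)=1$ and $\sum_{i+j=r}P^i\chi(P^j)=0$ for $r\ge1$. Put $\widehat{P}^r=(-1)^r\chi(P^r)$. $p_k=(p^k-1)/(p-1)$ for $k\ge0$. $w(k)=\det\big(x_j^{p^{i-1}}\big)_{1\le i,j\le k}$, with $w(0)=1$. *)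

theory Defs
  imports
    Berlekamp_Zassenhaus.Finite_Field
    Jordan_Normal_Form.Determinant
    "HOL-Library.Poly_Mapping"
begin

section \<open>Polynomials over the prime field\<close>

text \<open>
  The prime field of order \<open>p = CARD('p)\<close> is \<open>'p mod_ring\<close> with \<open>'p :: prime_card\<close>. A polynomial is a
  finitely supported map from monomials (finitely supported exponent functions) to coefficients,
  multiplied by convolution. The type has one variable for every natural number; the ring in
  \<open>x\<^sub>1, \<dots>, x\<^sub>n\<close> is the subring \<open>poly_ring {1..n}\<close>.
\<close>

type_synonym 'p fpoly = "(nat \<Rightarrow>\<^sub>0 nat) \<Rightarrow>\<^sub>0 'p mod_ring"

definition const :: "'p::prime_card mod_ring \<Rightarrow> 'p fpoly" where
  "const c = Poly_Mapping.single 0 c"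

definition X :: "nat \<Rightarrow> 'p::prime_card fpoly" where
  "X i = Poly_Mapping.single (Poly_Mapping.single i 1) 1"

definition poly_ring :: "nat set \<Rightarrow> 'p::prime_card fpoly set" where
  "poly_ring V = {f. \<forall>m\<in>Poly_Mapping.keys f. Poly_Mapping.keys m \<subseteq> V}"


section \<open>The action of the Steenrod powers\<close>

definition is_steenrod_action ::
    "nat set \<Rightarrow> (nat \<Rightarrow> 'p::prime_card fpoly \<Rightarrow> 'p fpoly) \<Rightarrow> bool" where
  "is_steenrod_action V P \<longleftrightarrow>
     (\<forall>r. \<forall>f\<in>poly_ring V. P r f \<in> poly_ring V) \<and>
     (\<forall>r. \<forall>f\<in>poly_ring V. \<forall>g\<in>poly_ring V. P r (f + g) = P r f + P r g) \<and>
     (\<forall>r c. \<forall>f\<in>poly_ring V. P r (const c * f) = const c * P r f) \<and>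
     (\<forall>f\<in>poly_ring V. P 0 f = f) \<and>
     (\<forall>i\<in>V. P 1 (X i) = X i ^ CARD('p)) \<and>
     (\<forall>r>1. \<forall>i\<in>V. P r (X i) = 0) \<and>
     (\<forall>r>0. P r 1 = 0) \<and>
     (\<forall>r. \<forall>f\<in>poly_ring V. \<forall>g\<in>poly_ring V. P r (f * g) = (\<Sum>s\<le>r. P s f * P (r - s) g))"

text \<open>
  The action on polynomials in all the variables. It exists and is unique
  (\<open>steenrod_power_action\<close>, \<open>steenrod_power_unique\<close>), and on polynomials in a set \<open>V\<close> of variables
  it agrees with every action on that subring (\<open>steenrod_action_on_subring\<close>).
\<close>

definition steenrod_power :: "nat \<Rightarrow> 'p::prime_card fpoly \<Rightarrow> 'p fpoly" where
  "steenrod_power = (THE P. is_steenrod_action UNIV P)"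

text \<open>
  The action of \<open>\<chi>(P\<^sup>r)\<close>: this is the relation \<open>\<Sum>\<^sub>i\<^sub>+\<^sub>j\<^sub>=\<^sub>r P\<^sup>i \<chi>(P\<^sup>j) = 0\<close> solved for its term with
  \<open>i = 0\<close>. The lemma \<open>antipode_power_unique\<close> shows that it is the action of \<open>\<chi>(P\<^sup>r)\<close> for every algebra
  acting on the polynomials and every \<open>\<chi>\<close> on it that satisfies these relations.
\<close>

fun antipode_power :: "nat \<Rightarrow> 'p::prime_card fpoly \<Rightarrow> 'p fpoly" where
  "antipode_power 0 f = f"
| "antipode_power (Suc r) f = - (\<Sum>i\<le>r. steenrod_power (Suc i) (antipode_power (r - i) f))"

definition steenrod_hat :: "nat \<Rightarrow> 'p::prime_card fpoly \<Rightarrow> 'p fpoly" where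
  "steenrod_hat r f = (- 1) ^ r * antipode_power r f"


section \<open>The numbers \<open>p\<^sub>k\<close> and the determinants \<open>w(k)\<close>\<close>

definition rep_num :: "nat \<Rightarrow> nat \<Rightarrow> nat" where
  "rep_num p k = (p ^ k - 1) div (p - 1)"

text \<open>Rows and columns of \<open>mat\<close> are numbered from 0; the determinant of the empty matrix is 1.\<close>

definition w :: "nat \<Rightarrow> 'p::prime_card fpoly" where
  "w k = det (mat k k (\<lambda>(i, j). X (Suc j) ^ (CARD('p) ^ i)))"

lemma w_0: "w 0 = 1"
  by (simp add: w_def det_def)


section \<open>Existence and uniqueness of the action\<close>

subsection \<open>Decomposition into monomials\<close>

lemma poly_mapping_sum_single:
  assumes "finite S" "Poly_Mapping.keys f \<subseteq> S"
  shows "(\<Sum>m\<in>S. Poly_Mapping.single m (Poly_Mapping.lookup f m)) = f"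
proof (rule poly_mapping_eqI)
  fix k
  have "Poly_Mapping.lookup (\<Sum>m\<in>S. Poly_Mapping.single m (Poly_Mapping.lookup f m)) k
      = (\<Sum>m\<in>S. if k = m then Poly_Mapping.lookup f k else 0)"
    by (auto simp: lookup_sum lookup_single when_def intro!: sum.cong)
  also have "\<dots> = Poly_Mapping.lookup f k"
    using assms by (auto simp: in_keys_iff subset_iff)
  finally show "Poly_Mapping.lookup (\<Sum>m\<in>S. Poly_Mapping.single m (Poly_Mapping.lookup f m)) k
      = Poly_Mapping.lookup f k" .
qed

lemma prod_single:
  "finite S \<Longrightarrow> (\<Prod>i\<in>S. Poly_Mapping.single (h i) (1::'b::comm_ring_1))
     = Poly_Mapping.single (\<Sum>i\<in>S. h i :: 'm::comm_monoid_add) 1"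
  by (induction S rule: finite_induct) (simp_all add: mult_single)

lemma X_power: "X i ^ k = Poly_Mapping.single (Poly_Mapping.single i k) 1"
  by (induction k) (simp_all add: X_def mult_single single_add [symmetric])

lemma monomial_prod:
  "(Poly_Mapping.single m 1 :: 'p::prime_card fpoly)
     = (\<Prod>i\<in>Poly_Mapping.keys m. X i ^ Poly_Mapping.lookup m i)"
  unfolding X_power using poly_mapping_sum_single [of "Poly_Mapping.keys m" m]
  by (simp add: prod_single)

lemma poly_ring_0: "0 \<in> poly_ring V" and poly_ring_1: "1 \<in> poly_ring V"
  by (auto simp: poly_ring_def)

lemma poly_ring_const: "const c \<in> poly_ring V"
  by (auto simp: poly_ring_def const_def)

lemma poly_ring_X: "i \<in> V \<Longrightarrow> X i \<in> poly_ring V"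
  by (auto simp: poly_ring_def X_def)

lemma poly_ring_add: "f \<in> poly_ring V \<Longrightarrow> g \<in> poly_ring V \<Longrightarrow> f + g \<in> poly_ring V"
  using keys_add [of f g] by (auto simp: poly_ring_def)

lemma keys_add_nat:
  "Poly_Mapping.keys (a + b :: 'x \<Rightarrow>\<^sub>0 nat) = Poly_Mapping.keys a \<union> Poly_Mapping.keys b"
  by (auto simp: in_keys_iff lookup_add)

lemma poly_ring_mult: "f \<in> poly_ring V \<Longrightarrow> g \<in> poly_ring V \<Longrightarrow> f * g \<in> poly_ring V"
  using keys_mult [of f g] by (fastforce simp: poly_ring_def keys_add_nat)

lemma poly_ring_uminus: "f \<in> poly_ring V \<Longrightarrow> - f \<in> poly_ring V"
  by (auto simp: poly_ring_def in_keys_iff)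

lemma poly_ring_sum: "(\<And>i. i \<in> S \<Longrightarrow> h i \<in> poly_ring V) \<Longrightarrow> sum h S \<in> poly_ring V"
  by (induction S rule: infinite_finite_induct) (auto simp: poly_ring_0 poly_ring_add)

lemma poly_ring_power: "f \<in> poly_ring V \<Longrightarrow> f ^ k \<in> poly_ring V"
  by (induction k) (auto simp: poly_ring_1 poly_ring_mult)

lemma poly_ring_UNIV: "poly_ring UNIV = UNIV"
  by (auto simp: poly_ring_def)

lemma poly_ring_induct [consumes 1, case_names one X const add mult]:
  assumes f: "f \<in> poly_ring V"
    and 1: "Q 1"
    and X: "\<And>i. i \<in> V \<Longrightarrow> Q (X i)"
    and const: "\<And>c f. f \<in> poly_ring V \<Longrightarrow> Q f \<Longrightarrow> Q (const c * f)"
    and add: "\<And>f g. f \<in> poly_ring V \<Longrightarrow> g \<in> poly_ring V \<Longrightarrow> Q f \<Longrightarrow> Q g \<Longrightarrow> Q (f + g)"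
    and mult: "\<And>f g. f \<in> poly_ring V \<Longrightarrow> g \<in> poly_ring V \<Longrightarrow> Q f \<Longrightarrow> Q g \<Longrightarrow> Q (f * g)"
  shows "Q f"
proof -
  let ?R = "\<lambda>f. f \<in> poly_ring V \<and> Q f"
  have pow: "?R (X i ^ k)" if "i \<in> V" for i k
    by (induction k) (use that 1 X mult in \<open>auto simp: poly_ring_1 poly_ring_mult poly_ring_X\<close>)
  have prod: "?R (\<Prod>i\<in>S. X i ^ k i)" if "finite S" "S \<subseteq> V" for S k
    using that
    by (induction S rule: finite_induct) (use pow 1 mult in \<open>auto simp: poly_ring_1 poly_ring_mult\<close>)
  have mono: "?R (const c * Poly_Mapping.single m 1)" if "Poly_Mapping.keys m \<subseteq> V" for m c
  proof -
    have "?R (Poly_Mapping.single m 1)"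
      unfolding monomial_prod by (rule prod) (use that in auto)
    then show ?thesis using const by (auto simp: poly_ring_mult poly_ring_const)
  qed
  have z: "?R 0"
    using const [OF poly_ring_1 1, of 0] by (simp add: const_def poly_ring_0)
  have sum: "?R (\<Sum>m\<in>S. const (c m) * Poly_Mapping.single m 1)"
    if "finite S" "\<forall>m\<in>S. Poly_Mapping.keys m \<subseteq> V" for S and c :: "_ \<Rightarrow> 'a mod_ring"
    using that
  proof (induction S rule: finite_induct)
    case (insert m S)
    then show ?case
      using mono [of m "c m"] add [of "const (c m) * Poly_Mapping.single m 1"]
      by (simp add: poly_ring_add)
  qed (use z in simp)
  have "f = (\<Sum>m\<in>Poly_Mapping.keys f. const (Poly_Mapping.lookup f m) * Poly_Mapping.single m 1)"
    using poly_mapping_sum_single [of "Poly_Mapping.keys f" f] by (simp add: const_def mult_single)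
  with sum [of "Poly_Mapping.keys f" "Poly_Mapping.lookup f"] f show ?thesis
    by (simp add: poly_ring_def)
qed


subsection \<open>Uniqueness\<close>

lemma is_steenrod_actionD:
  fixes P :: "nat \<Rightarrow> 'p::prime_card fpoly \<Rightarrow> 'p fpoly"
  assumes "is_steenrod_action V P"
  shows "f \<in> poly_ring V \<Longrightarrow> P r f \<in> poly_ring V"
    and "f \<in> poly_ring V \<Longrightarrow> g \<in> poly_ring V \<Longrightarrow> P r (f + g) = P r f + P r g"
    and "f \<in> poly_ring V \<Longrightarrow> P r (const c * f) = const c * P r f"
    and "f \<in> poly_ring V \<Longrightarrow> P 0 f = f"
    and "i \<in> V \<Longrightarrow> P 1 (X i) = X i ^ CARD('p)"
    and "r > 1 \<Longrightarrow> i \<in> V \<Longrightarrow> P r (X i) = 0"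
    and "r > 0 \<Longrightarrow> P r 1 = 0"
    and "f \<in> poly_ring V \<Longrightarrow> g \<in> poly_ring V \<Longrightarrow> P r (f * g) = (\<Sum>s\<le>r. P s f * P (r - s) g)"
  using assms unfolding is_steenrod_action_def by simp_all

lemma steenrod_action_unique:
  assumes P: "is_steenrod_action V P" and Q: "is_steenrod_action W Q"
    and VW: "V \<subseteq> W" and f: "f \<in> poly_ring V"
  shows "P r f = Q r f"
proof -
  note p = is_steenrod_actionD [OF P] and q = is_steenrod_actionD [OF Q]
  have sub: "g \<in> poly_ring W" if "g \<in> poly_ring V" for g :: "'a fpoly"
    using that VW by (auto simp: poly_ring_def)
  from f have "\<forall>r. P r f = Q r f"
  proof (induction rule: poly_ring_induct)
    case one
    have "P r 1 = Q r 1" for r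
      by (cases "r = 0") (simp_all add: p(4,7) q(4,7) poly_ring_1)
    then show ?case by blast
  next
    case (X i)
    have "P r (X i) = Q r (X i)" for r
    proof -
      consider "r = 0" | "r = 1" | "r > 1" by linarith
      then show ?thesis
      proof cases
        case 1
        with X VW show ?thesis by (auto simp: p(4) q(4) poly_ring_X sub)
      next
        case 2
        with X VW p(5) [of i] q(5) [of i] show ?thesis by auto
      next
        case 3
        with X VW show ?thesis by (auto simp: p(6) q(6))
      qed
    qed
    then show ?case by blast
  next
    case (const c f)
    then show ?case by (simp add: p(3) q(3) sub)
  next
    case (add f g)
    then show ?case by (simp add: p(2) q(2) sub)
  next
    case (mult f g)
    then show ?case by (simp add: p(8) q(8) sub)
  qed
  then show ?thesis by blast
qed


subsection \<open>Existence\<close>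

text \<open>
  The operation \<open>\<Sum>\<^sub>r P\<^sup>r t\<^sup>r\<close> is the ring homomorphism that substitutes \<open>x\<^sub>i + x\<^sub>i\<^sup>p t\<close> for \<open>x\<^sub>i\<close>.
\<close>

definition total_mono :: "(nat \<Rightarrow>\<^sub>0 nat) \<Rightarrow> 'p::prime_card fpoly poly" where
  "total_mono m = (\<Prod>i\<in>Poly_Mapping.keys m. [:X i, X i ^ CARD('p):] ^ Poly_Mapping.lookup m i)"

definition total_power :: "'p::prime_card fpoly \<Rightarrow> 'p fpoly poly" where
  "total_power f =
     (\<Sum>m\<in>Poly_Mapping.keys f. smult (const (Poly_Mapping.lookup f m)) (total_mono m))"

lemma total_mono_superset:
  fixes m :: "nat \<Rightarrow>\<^sub>0 nat"
  assumes "finite S" "Poly_Mapping.keys m \<subseteq> S"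
  shows "(total_mono m :: 'p::prime_card fpoly poly)
    = (\<Prod>i\<in>S. [:X i, X i ^ CARD('p):] ^ Poly_Mapping.lookup m i)"
  unfolding total_mono_def
  by (rule prod.mono_neutral_left) (use assms in \<open>auto simp: in_keys_iff\<close>)

lemma total_mono_0: "total_mono 0 = 1"
  by (simp add: total_mono_def)

lemma total_mono_add:
  "(total_mono (a + b) :: 'p::prime_card fpoly poly) = total_mono a * total_mono b"
proof -
  let ?S = "Poly_Mapping.keys a \<union> Poly_Mapping.keys b"
  have eq: "(total_mono m :: 'p fpoly poly)
      = (\<Prod>i\<in>?S. [:X i, X i ^ CARD('p):] ^ Poly_Mapping.lookup m i)"
    if "Poly_Mapping.keys m \<subseteq> ?S" for m
    by (rule total_mono_superset) (use that in auto)
  show ?thesis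
    by (simp add: eq keys_add_nat lookup_add power_add prod.distrib)
qed

lemma total_power_superset:
  assumes "finite S" "Poly_Mapping.keys f \<subseteq> S"
  shows "total_power f = (\<Sum>m\<in>S. smult (const (Poly_Mapping.lookup f m)) (total_mono m))"
  unfolding total_power_def
  by (rule sum.mono_neutral_left) (use assms in \<open>auto simp: in_keys_iff const_def\<close>)

lemma const_add: "const (a + b) = const a + const b"
  by (simp add: const_def single_add)

lemma const_mult: "const (a * b) = const a * const b"
  by (simp add: const_def mult_single)

lemma total_power_add: "total_power (f + g) = total_power f + total_power g"
proof -
  let ?S = "Poly_Mapping.keys f \<union> Poly_Mapping.keys g"
  show ?thesis
    using total_power_superset [of ?S f] total_power_superset [of ?S g]
      total_power_superset [of ?S "f + g"] keys_add [of f g]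
    by (simp add: lookup_add const_add smult_add_left sum.distrib)
qed

lemma total_power_0: "total_power 0 = 0"
  by (simp add: total_power_def)

lemma total_power_sum: "total_power (sum h S) = (\<Sum>i\<in>S. total_power (h i))"
  by (induction S rule: infinite_finite_induct) (simp_all add: total_power_0 total_power_add)

lemma total_power_single: "total_power (Poly_Mapping.single m c) = smult (const c) (total_mono m)"
  using total_power_superset [of "{m}" "Poly_Mapping.single m c"] by simp

lemma total_power_mult: "total_power (f * g) = total_power f * total_power g"
proof -
  let ?f = "\<lambda>m. Poly_Mapping.single m (Poly_Mapping.lookup f m)"
  let ?g = "\<lambda>m. Poly_Mapping.single m (Poly_Mapping.lookup g m)"
  let ?F = "Poly_Mapping.keys f" and ?G = "Poly_Mapping.keys g"
  have f: "(\<Sum>m\<in>?F. ?f m) = f" and g: "(\<Sum>m\<in>?G. ?g m) = g"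
    by (simp_all add: poly_mapping_sum_single)
  have "total_power ((\<Sum>m\<in>?F. ?f m) * (\<Sum>m\<in>?G. ?g m))
      = (\<Sum>m\<in>?F. \<Sum>k\<in>?G. total_power (?f m * ?g k))"
    by (simp only: sum_product total_power_sum)
  also have "\<dots> = (\<Sum>m\<in>?F. \<Sum>k\<in>?G. total_power (?f m) * total_power (?g k))"
    by (simp add: mult_single total_power_single total_mono_add const_mult ac_simps)
  also have "\<dots> = total_power (\<Sum>m\<in>?F. ?f m) * total_power (\<Sum>m\<in>?G. ?g m)"
    by (simp only: sum_product total_power_sum)
  finally show ?thesis by (simp only: f g)
qed

lemma total_power_const: "total_power (const c) = [:const c:]"
  by (simp add: const_def [of c] total_power_single total_mono_0)

lemma total_power_1: "total_power 1 = 1"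
  using total_power_single [of 0 1] by (simp add: const_def total_mono_0 one_pCons)

lemma total_power_X:
  "total_power (X i :: 'p::prime_card fpoly) = [:X i, X i ^ CARD('p):]"
  by (subst (1) X_def) (simp add: total_power_single total_mono_def const_def)

lemma coeff_0_total_power: "coeff (total_power f) 0 = f"
proof -
  have "f \<in> poly_ring UNIV" by (simp add: poly_ring_UNIV)
  then show ?thesis
    by (induction rule: poly_ring_induct)
      (simp_all add: total_power_1 total_power_X total_power_mult total_power_const
        total_power_add coeff_mult)
qed

lemma coeff_total_power_closed:
  assumes "f \<in> poly_ring V"
  shows "coeff (total_power f) r \<in> poly_ring V"
proof -
  from assms have "\<forall>r. coeff (total_power f) r \<in> poly_ring V"
  proof (induction rule: poly_ring_induct)
    case one
    show ?case by (simp add: total_power_1 poly_ring_0 poly_ring_1)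
  next
    case (X i)
    then show ?case
      by (auto simp: total_power_X coeff_pCons poly_ring_0 poly_ring_X poly_ring_power split: nat.split)
  next
    case (const c f)
    then show ?case
      by (simp add: total_power_mult total_power_const poly_ring_mult poly_ring_const)
  next
    case (add f g)
    then show ?case by (simp add: total_power_add poly_ring_add)
  next
    case (mult f g)
    then show ?case by (auto simp: total_power_mult coeff_mult intro!: poly_ring_sum poly_ring_mult)
  qed
  then show ?thesis by blast
qed

lemma is_steenrod_action_total:
  "is_steenrod_action V (\<lambda>r f :: 'p::prime_card fpoly. coeff (total_power f) r)"
  unfolding is_steenrod_action_def
  by (auto simp: coeff_total_power_closed total_power_add total_power_mult total_power_const
      coeff_0_total_power total_power_X total_power_1 coeff_mult coeff_pCons split: nat.split)

theorem ex1_steenrod_action: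
  "\<exists>!P :: nat \<Rightarrow> 'p::prime_card fpoly \<Rightarrow> 'p fpoly. is_steenrod_action UNIV P"
proof (rule ex1I)
  fix P :: "nat \<Rightarrow> 'p fpoly \<Rightarrow> 'p fpoly"
  assume P: "is_steenrod_action UNIV P"
  show "P = (\<lambda>r f. coeff (total_power f) r)"
    using steenrod_action_unique [OF P is_steenrod_action_total [of UNIV]]
    by (intro ext) (simp add: poly_ring_UNIV)
qed (rule is_steenrod_action_total)

theorem steenrod_power_action: "is_steenrod_action UNIV steenrod_power"
  unfolding steenrod_power_def by (rule theI' [OF ex1_steenrod_action])

theorem steenrod_power_unique: "is_steenrod_action UNIV P \<Longrightarrow> P = steenrod_power"
  using ex1_steenrod_action steenrod_power_action by blast

lemma steenrod_power_eq_coeff: "steenrod_power = (\<lambda>r f. coeff (total_power f) r)"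
  by (rule sym, rule steenrod_power_unique) (rule is_steenrod_action_total)

theorem steenrod_power_restricts: "is_steenrod_action V steenrod_power"
  unfolding steenrod_power_eq_coeff by (rule is_steenrod_action_total)

theorem steenrod_action_on_subring:
  "is_steenrod_action V P \<Longrightarrow> f \<in> poly_ring V \<Longrightarrow> P r f = steenrod_power r f"
  by (rule steenrod_action_unique [OF _ steenrod_power_action]) auto


subsection \<open>The action of \<open>\<chi>(P\<^sup>r)\<close>\<close>

lemma steenrod_power_0: "steenrod_power 0 f = f"
  by (rule is_steenrod_actionD(4) [OF steenrod_power_action]) (simp add: poly_ring_UNIV)

lemma antipode_power_relation:
  "r \<ge> 1 \<Longrightarrow> (\<Sum>i\<le>r. steenrod_power i (antipode_power (r - i) f)) = 0"
  by (cases r) (simp_all add: steenrod_power_0 sum.atMost_Suc_shift del: sum.atMost_Suc)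

lemma antipode_power_closed: "f \<in> poly_ring V \<Longrightarrow> antipode_power r f \<in> poly_ring V"
  by (induction r f rule: antipode_power.induct)
    (auto intro!: poly_ring_uminus poly_ring_sum is_steenrod_actionD(1) [OF steenrod_power_restricts])

theorem antipode_power_unique:
  fixes P :: "nat \<Rightarrow> 'a::ring_1"
    and act :: "'a \<Rightarrow> 'p::prime_card fpoly \<Rightarrow> 'p fpoly"
    and \<chi> :: "'a \<Rightarrow> 'a"
  assumes one: "\<And>f. f \<in> poly_ring V \<Longrightarrow> act 1 f = f"
    and add: "\<And>a b f. f \<in> poly_ring V \<Longrightarrow> act (a + b) f = act a f + act b f"
    and mult: "\<And>a b f. f \<in> poly_ring V \<Longrightarrow> act (a * b) f = act a (act b f)"
    and action: "is_steenrod_action V (\<lambda>r. act (P r))"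
    and P0: "P 0 = 1" and chi1: "\<chi> 1 = 1"
    and chi: "\<And>r. r \<ge> 1 \<Longrightarrow> (\<Sum>i\<le>r. P i * \<chi> (P (r - i))) = 0"
    and f: "f \<in> poly_ring V"
  shows "act (\<chi> (P r)) f = antipode_power r f"
proof (induction r rule: less_induct)
  case (less r)
  have zero: "act 0 f = 0"
    using add [OF f, of 0 0] by (simp only: add_0_left add_cancel_right_right)
  have sum: "act (sum h S) f = (\<Sum>i\<in>S. act (h i) f)" for h and S :: "nat set"
    by (induction S rule: infinite_finite_induct) (simp_all add: zero add [OF f])
  show ?case
  proof (cases r)
    case 0
    then show ?thesis by (simp add: P0 chi1 one [OF f])
  next
    case (Suc k)
    have "0 = act (\<Sum>i\<le>Suc k. P i * \<chi> (P (Suc k - i))) f"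
      using chi [of "Suc k"] zero by (simp del: sum.atMost_Suc)
    also have "\<dots> = (\<Sum>i\<le>Suc k. act (P i) (act (\<chi> (P (Suc k - i))) f))"
      by (simp only: sum mult [OF f])
    also have "\<dots> = act (P 0) (act (\<chi> (P (Suc k))) f)
        + (\<Sum>i\<le>k. act (P (Suc i)) (act (\<chi> (P (k - i))) f))"
      by (simp add: sum.atMost_Suc_shift del: sum.atMost_Suc)
    also have "act (P 0) (act (\<chi> (P (Suc k))) f) = act (\<chi> (P (Suc k))) f"
      by (simp add: P0 flip: mult [OF f])
    also have "(\<Sum>i\<le>k. act (P (Suc i)) (act (\<chi> (P (k - i))) f))
        = (\<Sum>i\<le>k. steenrod_power (Suc i) (antipode_power (k - i) f))"
      using less steenrod_action_on_subring [OF action antipode_power_closed [OF f]]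
      by (simp add: Suc)
    finally show ?thesis
      unfolding Suc antipode_power.simps eq_neg_iff_add_eq_0 by (rule sym)
  qed
qed

end

theory Submission
  imports Defs "HOL-Computational_Algebra.Formal_Power_Series"
begin

text \<open>
  Write \<open>q = CARD('p)\<close>, \<open>p\<^sub>k = rep_num q k\<close>, and let \<open>t\<close> be the variable of formal power series. The
  generating series \<open>hat_total f = \<Sum>\<^sub>r steenrod_hat r f t\<^sup>r\<close> is multiplicative in \<open>f\<close>, because it is
  inverse to the signed total Steenrod power, and \<open>S = hat_total x\<close> satisfies
  \<open>S = x + t S\<^sup>q\<close> for a variable \<open>x\<close> (\<open>hat_total_X_fixpoint\<close>), so that \<open>S = \<Sum>\<^sub>k x\<^bsup>q^k\<^esup> t\<^bsup>p\<^sub>k\<^esup>\<close>. Put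
  \<open>S\<^sub>i = hat_total x\<^sub>i\<close>, \<open>m = n - 1\<close> and \<open>Q = (S\<^sub>1 \<cdots> S\<^sub>m)\<^bsup>q-1\<^esup>\<close>. The theorem computes the coefficient
  of \<open>t\<^sup>E\<close> in \<open>Q S\<^sub>n\<^sup>b\<close> for \<open>E = (b + 1) p\<^sub>m - m\<close>.

  A term of a product of \<open>k\<close> of the series \<open>S\<^sub>i\<close> has, in the variables \<open>x\<^sub>i\<close>, a degree that is a sum
  of \<open>k\<close> powers of \<open>q\<close>, and that degree is \<open>(q - 1) e + k\<close> when the term belongs to \<open>t\<^sup>e\<close>. In
  \<open>Q S\<^sub>n\<^sup>b\<close> the exponent \<open>E\<close> corresponds to the degree \<open>(b + 1) q\<^sup>m - 1\<close>, whose digit sum in base \<open>q\<close>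
  is \<open>m (q - 1) + b\<close>, exactly the number of factors. Hence a product of the same degree in which
  a factor \<open>S\<^sub>i\<^sup>q\<close> occurs cannot contribute: the degrees of the terms of \<open>S\<^sub>i\<^sup>q\<close> are single powers of
  \<open>q\<close>, so too few powers remain. As far as the coefficient at \<open>t\<^sup>E\<close> is concerned, \<open>S\<^sub>i Q = 0\<close> for
  \<open>i \<le> m\<close>, and Gaussian elimination may be applied to the factor \<open>S\<^sub>n\<close>.

  The elimination uses the cofactors \<open>C\<^sub>i\<close> of the last row of the matrix that defines \<open>w n\<close>; here
  \<open>C\<^sub>n = w m\<close>. They kill the powers \<open>x\<^bsup>q^k\<^esup>\<close> with \<open>k < m\<close>, whence
  \<open>\<Sum>\<^sub>i C\<^sub>i S\<^sub>i = w n t\<^bsup>p\<^sub>m\<^esup> + \<cdots>\<close> with omitted terms of too high order to matter. Replacing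
  \<open>w m S\<^sub>n\<close> by this series gives (\<open>coefficient_elimination\<close>)
  \<open>(w m)\<^sup>b [t\<^sup>E] (Q S\<^sub>n\<^sup>b) = (w n)\<^sup>b [t\<^bsup>p\<^sub>m - m\<^esup>] Q\<close>. For \<open>b = q - 1\<close> the series on the left is the \<open>Q\<close>
  belonging to \<open>m + 1\<close>, so induction on \<open>m\<close> yields \<open>[t\<^bsup>p\<^sub>m - m\<^esup>] Q = (w m)\<^bsup>q-1\<^esup>\<close>. Cancelling
  \<open>(w m)\<^sup>b \<noteq> 0\<close> gives the result.
\<close>

section \<open>The total conjugate Steenrod operation\<close>

lemma steenrod_power_add: "steenrod_power r (f + g) = steenrod_power r f + steenrod_power r g"
  using is_steenrod_actionD(2) [OF steenrod_power_action] by (simp add: poly_ring_UNIV)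

lemma steenrod_power_mult:
  "steenrod_power r (f * g) = (\<Sum>s\<le>r. steenrod_power s f * steenrod_power (r - s) g)"
  using is_steenrod_actionD(8) [OF steenrod_power_action] by (simp add: poly_ring_UNIV)

lemma steenrod_power_zero [simp]: "steenrod_power r 0 = 0"
  by (metis add.right_neutral add_left_cancel steenrod_power_add)

lemma steenrod_power_sum: "steenrod_power r (sum h A) = (\<Sum>i\<in>A. steenrod_power r (h i))"
  by (induction A rule: infinite_finite_induct) (simp_all add: steenrod_power_add)

lemma steenrod_power_uminus: "steenrod_power r (- f) = - steenrod_power r f"
  using steenrod_power_add [of r f "- f"] by (simp add: eq_neg_iff_add_eq_0 add.commute)

lemma steenrod_power_sign: "steenrod_power r ((- 1) ^ j * f) = (- 1) ^ j * steenrod_power r f"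
  by (induction j) (simp_all add: steenrod_power_uminus)

lemma steenrod_power_one:
  "steenrod_power r (1 :: 'p::prime_card fpoly) = (if r = 0 then 1 else 0)"
  using is_steenrod_actionD(7) [OF steenrod_power_action [where 'a = 'p]] by (simp add: steenrod_power_0)

lemma steenrod_power_X:
  "steenrod_power r (X i :: 'p::prime_card fpoly)
     = (if r = 0 then X i else if r = 1 then X i ^ CARD('p) else 0)"
  using is_steenrod_actionD(5,6) [OF steenrod_power_action [where 'a = 'p]]
  by (auto simp: steenrod_power_0)

text \<open>
  The operation \<open>\<Sum>\<^sub>i (-1)\<^sup>i P\<^sup>i t\<^sup>i\<close>, extended \<open>t\<close>-linearly to power series in \<open>t\<close>.
\<close>

definition signed_total :: "'p::prime_card fpoly fps \<Rightarrow> 'p fpoly fps" where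
  "signed_total F = Abs_fps (\<lambda>r. \<Sum>i\<le>r. (- 1) ^ i * steenrod_power i (fps_nth F (r - i)))"

definition hat_total :: "'p::prime_card fpoly \<Rightarrow> 'p fpoly fps" where
  "hat_total f = Abs_fps (\<lambda>r. steenrod_hat r f)"

lemma signed_total_nth:
  "fps_nth (signed_total F) r = (\<Sum>i\<le>r. (- 1) ^ i * steenrod_power i (fps_nth F (r - i)))"
  by (simp add: signed_total_def)

lemma signed_total_add: "signed_total (F + G) = signed_total F + signed_total G"
  by (rule fps_ext) (simp add: signed_total_nth steenrod_power_add algebra_simps sum.distrib)

text \<open>
  This is the Cartan formula. Both sides expand into products of a Steenrod power of a coefficient
  of \<open>F\<close> and one of a coefficient of \<open>G\<close> with four indices of sum \<open>r\<close>, grouped in different ways.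
\<close>

lemma signed_total_mult: "signed_total (F * G) = signed_total F * signed_total G"
proof (rule fps_ext)
  fix r
  let ?P = "steenrod_power" and ?F = "fps_nth F" and ?G = "fps_nth G"
  have "fps_nth (signed_total (F * G)) r
      = (\<Sum>i\<le>r. \<Sum>s\<le>r - i. \<Sum>a\<le>i. (- 1) ^ i * (?P a (?F s) * ?P (i - a) (?G (r - i - s))))"
    by (simp add: signed_total_nth fps_mult_nth atLeast0AtMost steenrod_power_sum
        steenrod_power_mult sum_distrib_left)
  also have "\<dots> = (\<Sum>(i, s, a)\<in>(SIGMA i:{..r}. {..r - i} \<times> {..i}).
      (- 1) ^ i * (?P a (?F s) * ?P (i - a) (?G (r - i - s))))"
    by (simp add: sum.Sigma sum.cartesian_product)
  also have "\<dots> = (\<Sum>(q, a, b)\<in>(SIGMA q:{..r}. {..q} \<times> {..r - q}).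
      ((- 1) ^ a * ?P a (?F (q - a))) * ((- 1) ^ b * ?P b (?G (r - q - b))))"
    by (rule sum.reindex_bij_witness [where
          j = "\<lambda>(i, s, a). (a + s, a, i - a)" and i = "\<lambda>(q, a, b). (a + b, q - a, a)"])
      (auto simp: power_add [symmetric] algebra_simps)
  also have "\<dots> = (\<Sum>q\<le>r. \<Sum>a\<le>q. \<Sum>b\<le>r - q.
      ((- 1) ^ a * ?P a (?F (q - a))) * ((- 1) ^ b * ?P b (?G (r - q - b))))"
    by (simp add: sum.Sigma sum.cartesian_product)
  also have "\<dots> = fps_nth (signed_total F * signed_total G) r"
    by (simp add: signed_total_nth fps_mult_nth atLeast0AtMost sum_product)
  finally show "fps_nth (signed_total (F * G)) r = fps_nth (signed_total F * signed_total G) r" .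
qed

text \<open>
  As \<open>P\<^sup>0\<close> is the identity, the operation is unitriangular: \<open>F\<close> is recovered coefficient by
  coefficient.
\<close>

lemma signed_total_inject:
  assumes "signed_total F = signed_total G"
  shows "F = G"
proof (rule fps_ext)
  fix r
  have split: "fps_nth (signed_total H) r = fps_nth H r
      + (\<Sum>i\<in>{1..r}. (- 1) ^ i * steenrod_power i (fps_nth H (r - i)))"
    for H :: "'a fpoly fps" and r
  proof -
    have "{..r} = insert 0 {1..r}" by auto
    then show ?thesis by (simp add: signed_total_nth steenrod_power_0)
  qed
  show "fps_nth F r = fps_nth G r"
  proof (induction r rule: less_induct)
    case (less r)
    then show ?case
      using arg_cong [OF assms, of "\<lambda>H. fps_nth H r"] unfolding split by simp
  qed
qed

lemma signed_total_const_X: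
  "signed_total (fps_const (X i :: 'p::prime_card fpoly))
     = fps_const (X i) - fps_X * fps_const (X i) ^ CARD('p)"
proof (rule fps_ext)
  fix r
  have "fps_nth (signed_total (fps_const (X i :: 'p fpoly))) r
      = (\<Sum>j\<le>r. if j = r then (- 1) ^ r * steenrod_power r (X i) else 0)"
    unfolding signed_total_nth by (rule sum.cong) auto
  then show "fps_nth (signed_total (fps_const (X i :: 'p fpoly))) r
      = fps_nth (fps_const (X i) - fps_X * fps_const (X i) ^ CARD('p)) r"
    by (cases r) (auto simp: steenrod_power_X steenrod_power_0 fps_const_power)
qed

lemma signed_total_fps_X: "signed_total fps_X = fps_X"
proof (rule fps_ext)
  fix r
  have "fps_nth (signed_total (fps_X :: 'a fpoly fps)) r
      = (\<Sum>j\<le>r. if j = 0 then fps_nth fps_X r else 0)"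
    unfolding signed_total_nth
    by (rule sum.cong) (auto simp: fps_X_nth steenrod_power_one steenrod_power_0)
  then show "fps_nth (signed_total (fps_X :: 'a fpoly fps)) r = fps_nth fps_X r"
    by simp
qed

text \<open>
  The relations that define the antipode say that \<open>hat_total\<close> is a right inverse of \<open>signed_total\<close>.
  With injectivity, every identity about \<open>hat_total\<close> can be checked after applying \<open>signed_total\<close>.
\<close>

lemma signed_total_hat_total: "signed_total (hat_total f) = fps_const f"
proof (rule fps_ext)
  fix r
  have "fps_nth (signed_total (hat_total f)) r
      = (\<Sum>i\<le>r. (- 1) ^ r * steenrod_power i (antipode_power (r - i) f))"
    unfolding signed_total_nth hat_total_def fps_nth_Abs_fps steenrod_hat_def steenrod_power_sign
    by (rule sum.cong) (simp_all flip: mult.assoc power_add)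
  also have "\<dots> = (- 1) ^ r * (\<Sum>i\<le>r. steenrod_power i (antipode_power (r - i) f))"
    by (simp add: sum_distrib_left)
  also have "\<dots> = fps_nth (fps_const f) r"
    using antipode_power_relation [of r f] by (cases "r = 0") (simp_all add: steenrod_power_0)
  finally show "fps_nth (signed_total (hat_total f)) r = fps_nth (fps_const f) r" .
qed

lemma signed_total_one: "signed_total 1 = 1"
proof (rule fps_ext)
  fix r
  have "fps_nth (signed_total (1 :: 'a fpoly fps)) r
      = (\<Sum>j\<le>r. if j = 0 then fps_nth 1 r else 0)"
    unfolding signed_total_nth
    by (rule sum.cong) (auto simp: steenrod_power_one steenrod_power_0)
  then show "fps_nth (signed_total (1 :: 'a fpoly fps)) r = fps_nth 1 r"
    by simp
qed

lemma hat_total_mult: "hat_total (f * g) = hat_total f * hat_total g"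
  by (rule signed_total_inject)
    (simp add: signed_total_hat_total signed_total_mult fps_const_mult [symmetric] del: fps_const_mult)

lemma hat_total_one: "hat_total 1 = 1"
  by (rule signed_total_inject) (simp add: signed_total_hat_total signed_total_one)

lemma hat_total_power: "hat_total (f ^ k) = hat_total f ^ k"
  by (induction k) (simp_all add: hat_total_mult hat_total_one)

lemma hat_total_prod: "hat_total (prod h A) = (\<Prod>i\<in>A. hat_total (h i))"
  by (induction A rule: infinite_finite_induct) (simp_all add: hat_total_mult hat_total_one)

lemma signed_total_power: "signed_total (F ^ k) = signed_total F ^ k"
  by (induction k) (simp_all add: signed_total_mult signed_total_one)

text \<open>
  Under \<open>signed_total\<close> both sides become \<open>x\<close>, the right one as \<open>(x - t x\<^sup>q) + t x\<^sup>q\<close>.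
\<close>

lemma hat_total_X_fixpoint:
  "hat_total (X i :: 'p::prime_card fpoly)
     = fps_const (X i) + fps_X * hat_total (X i) ^ CARD('p)"
  by (rule signed_total_inject)
    (simp add: signed_total_hat_total signed_total_add signed_total_mult signed_total_power
      signed_total_fps_X signed_total_const_X)

section \<open>The series of a variable\<close>

lemma CHAR_fpoly: "CHAR('p::prime_card fpoly) = CARD('p)"
proof (rule CHAR_eqI)
  have *: "(of_nat k :: 'p fpoly) = Poly_Mapping.single 0 (of_nat k)" for k
    by simp
  show "of_nat CARD('p) = (0 :: 'p fpoly)"
    unfolding * by (metis semiring_char_mod_ring of_nat_CHAR single_zero)
  fix k assume "of_nat k = (0 :: 'p fpoly)"
  then show "CARD('p) dvd k"
    unfolding * using of_nat_0_mod_ring_dvd [of k, where 'a = 'p] by (metis lookup_single_eq lookup_zero)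
qed

lemma fps_frobenius_add:
  fixes F G :: "'p::prime_card fpoly fps"
  shows "(F + G) ^ (CARD('p) ^ k) = F ^ (CARD('p) ^ k) + G ^ (CARD('p) ^ k)"
  by (rule freshmans_dream') (simp_all add: CHAR_fpoly prime_card)

lemma rep_num_0 [simp]: "rep_num q 0 = 0"
  by (simp add: rep_num_def)

lemma rep_num_closed_form:
  assumes "q \<ge> 2"
  shows "(q - 1) * rep_num q k + 1 = q ^ k"
proof -
  have "\<exists>j. q ^ k = (q - 1) * j + 1"
  proof (induction k)
    case (Suc k)
    then obtain j where "q ^ k = (q - 1) * j + 1" by blast
    then have "q ^ Suc k = (q - 1) * (q * j + 1) + 1"
      using assms by (cases q) (simp_all add: algebra_simps)
    then show ?case by blast
  qed auto
  then obtain j where "q ^ k = (q - 1) * j + 1" by blast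
  then show ?thesis
    using assms by (simp add: rep_num_def)
qed

lemma rep_num_Suc:
  assumes "q \<ge> 2"
  shows "rep_num q (Suc k) = rep_num q k + q ^ k"
proof -
  have "(q - 1) * rep_num q (Suc k) = (q - 1) * (rep_num q k + q ^ k)"
    using rep_num_closed_form [OF assms, of "Suc k"] rep_num_closed_form [OF assms, of k] assms
    by (cases q) (simp_all add: algebra_simps)
  then show ?thesis using assms by simp
qed

lemma rep_num_Suc':
  assumes "q \<ge> 2"
  shows "rep_num q (Suc k) = q * rep_num q k + 1"
  using rep_num_Suc [OF assms, of k] rep_num_closed_form [OF assms, of k] assms
  by (cases q) (simp_all add: algebra_simps)

lemma rep_num_ge:
  assumes "q \<ge> 2"
  shows "k \<le> rep_num q k"
proof (induction k)
  case (Suc k)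
  moreover have "q ^ k \<ge> 1" using assms by simp
  ultimately show ?case by (simp add: rep_num_Suc [OF assms] del: One_nat_def)
qed simp

lemma rep_num_less_power:
  assumes "q \<ge> 2"
  shows "rep_num q k < q ^ k"
proof -
  have "1 * rep_num q k \<le> (q - 1) * rep_num q k"
    using assms by (intro mult_right_mono) auto
  then show ?thesis using rep_num_closed_form [OF assms, of k] by linarith
qed

lemma prime_card_ge_2: "CARD('p::prime_card) \<ge> 2"
  using prime_card [where 'a = 'p] by (rule prime_ge_2_nat)

text \<open>
  The fixed-point equation, iterated \<open>K\<close> times with the Frobenius map. The remainder is kept in closed
  form, so that it is seen to have order at least \<open>p\<^sub>K\<close>.
\<close>

lemma hat_total_X_expansion:
  fixes i :: nat
  defines "S \<equiv> hat_total (X i :: 'p::prime_card fpoly)"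
  shows "S = (\<Sum>k<K. fps_const (X i ^ CARD('p) ^ k) * fps_X ^ rep_num CARD('p) k)
             + fps_X ^ rep_num CARD('p) K * S ^ (CARD('p) ^ K)"
proof (induction K)
  case (Suc K)
  let ?q = "CARD('p)"
  have "S ^ (?q ^ K) = (fps_const (X i) + fps_X * S ^ ?q) ^ (?q ^ K)"
    using hat_total_X_fixpoint [of i, where 'p = 'p] by (simp add: S_def)
  also have "\<dots> = fps_const (X i ^ ?q ^ K) + fps_X ^ (?q ^ K) * S ^ (?q ^ Suc K)"
    by (simp add: fps_frobenius_add power_mult_distrib fps_const_power flip: power_mult)
  finally have step: "S ^ (?q ^ K) = \<dots>" .
  show ?case
    by (subst Suc, subst step)
      (simp add: rep_num_Suc [OF prime_card_ge_2] power_add algebra_simps)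
qed simp

section \<open>Sums of powers of a base\<close>

inductive sum_of_powers :: "nat \<Rightarrow> nat \<Rightarrow> nat \<Rightarrow> bool" for q where
  zero: "sum_of_powers q 0 0"
| add_power: "sum_of_powers q k d \<Longrightarrow> sum_of_powers q (Suc k) (d + q ^ i)"

lemma sum_of_powers_power: "sum_of_powers q 1 (q ^ i)"
  using sum_of_powers.add_power [OF sum_of_powers.zero, of q i] by simp

lemma sum_of_powers_add:
  assumes "sum_of_powers q k d" and "sum_of_powers q l e"
  shows "sum_of_powers q (k + l) (d + e)"
  using assms(2)
proof induction
  case (add_power l e i)
  then show ?case
    using sum_of_powers.add_power [of q "k + l" "d + e" i] by (simp add: ac_simps)
qed (use assms(1) in simp)

lemma sum_of_powers_ones: "sum_of_powers q c c"
proof (induction c)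
  case (Suc c)
  then show ?case using sum_of_powers.add_power [of q c c 0] by simp
qed (rule sum_of_powers.zero)

text \<open>
  The summands \<open>q\<^sup>0\<close> are separated from the rest, in which a factor \<open>q\<close> can be taken out.
\<close>

lemma sum_of_powers_split_ones:
  assumes "sum_of_powers q k d"
  shows "\<exists>r l e. k = r + l \<and> d = r + q * e \<and> sum_of_powers q l e"
  using assms
proof induction
  case zero
  then show ?case using sum_of_powers.zero by fastforce
next
  case (add_power k d i)
  then obtain r l e where *: "k = r + l" "d = r + q * e" "sum_of_powers q l e" by blast
  show ?case
  proof (cases i)
    case 0
    with * show ?thesis by (intro exI [of _ "Suc r"] exI [of _ l] exI [of _ e]) simp
  next
    case (Suc j)
    with * sum_of_powers.add_power [OF *(3), of j] show ?thesis
      by (intro exI [of _ r] exI [of _ "Suc l"] exI [of _ "e + q ^ j"]) (simp add: algebra_simps)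
  qed
qed

text \<open>
  The digits of \<open>d = (b + 1) q\<^sup>m - 1\<close> in base \<open>q\<close> are \<open>b\<close> followed by \<open>m\<close> times \<open>q - 1\<close>, and no sum of
  powers of \<open>q\<close> with value \<open>d\<close> is shorter than the digit sum. By induction on \<open>m\<close>: the number of ones is
  congruent to \<open>-1\<close> modulo \<open>q\<close>, hence equal to \<open>q - 1 + q c\<close>. Dropping \<open>q - 1\<close> ones, trading the other
  \<open>q c\<close> ones for \<open>c\<close> copies of \<open>q\<close> and dividing by \<open>q\<close> leads from \<open>m\<close> to \<open>m - 1\<close>.
\<close>

lemma sum_of_powers_min_length:
  assumes "b < q" and "sum_of_powers q k d" and "d + 1 = (b + 1) * q ^ m"
  shows "k \<ge> m * (q - 1) + b"
  using assms(2,3)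
proof (induction m arbitrary: k d)
  case 0
  then obtain r l e where *: "k = r + l" "d = r + q * e"
    using sum_of_powers_split_ones by blast
  with 0 assms(1) have "e = 0"
    by (cases e) auto
  with * 0 show ?case by simp
next
  case (Suc m)
  then obtain r l e where *: "k = r + l" "d = r + q * e" "sum_of_powers q l e"
    using sum_of_powers_split_ones by blast
  have eq: "r + 1 + q * e = q * ((b + 1) * q ^ m)"
    using Suc.prems(2) * by (simp add: algebra_simps)
  then have "q dvd r + 1"
    by (metis dvd_add_left_iff dvd_triv_left)
  then obtain c' where c': "r + 1 = q * c'" by blast
  then obtain c where c: "r + 1 = q * (c + 1)"
    by (cases c') auto
  have "q * (c + e + 1) = q * ((b + 1) * q ^ m)"
    using eq c by (simp add: algebra_simps)
  then have "c + e + 1 = (b + 1) * q ^ m"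
    using assms(1) by (subst (asm) mult_cancel1) simp
  then have "(e + c) + 1 = (b + 1) * q ^ m"
    by simp
  with Suc.IH [OF sum_of_powers_add [OF *(3) sum_of_powers_ones]]
  have "l + c \<ge> m * (q - 1) + b" .
  moreover have "r = (q - 1) + q * c" using c assms(1) by (cases q) auto
  moreover have "c \<le> q * c" using assms(1) by (cases q) auto
  moreover have "Suc m * (q - 1) = (q - 1) + m * (q - 1)" by simp
  ultimately show ?case using *(1) by linarith
qed

section \<open>Weights of power series\<close>

text \<open>
  If \<open>F\<close> is a product of series \<open>hat_total f\<close> with homogeneous \<open>f\<close>, of degree \<open>j\<close> in total, its
  coefficient at \<open>t\<^sup>e\<close> is homogeneous of degree \<open>(q - 1) e + j\<close>. The predicate says that only such
  degrees occur as are sums of \<open>k\<close> powers of \<open>q\<close>.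
\<close>

definition power_weighted :: "nat \<Rightarrow> nat \<Rightarrow> 'p::prime_card fpoly fps \<Rightarrow> bool" where
  "power_weighted j k F \<longleftrightarrow>
     (\<forall>e. fps_nth F e \<noteq> 0 \<longrightarrow> sum_of_powers CARD('p) k ((CARD('p) - 1) * e + j))"

lemma power_weighted_const: "power_weighted 0 0 (fps_const c)"
  by (auto simp: power_weighted_def sum_of_powers.zero)

lemma power_weighted_add:
  "power_weighted j k F \<Longrightarrow> power_weighted j k G \<Longrightarrow> power_weighted j k (F + G)"
  by (auto simp: power_weighted_def) (metis add_0)

lemma power_weighted_sum:
  "(\<And>i. i \<in> A \<Longrightarrow> power_weighted j k (h i)) \<Longrightarrow> power_weighted j k (sum h A)"
  by (induction A rule: infinite_finite_induct)
    (auto intro!: power_weighted_add simp: power_weighted_def [of _ _ 0])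

lemma power_weighted_mult:
  fixes F G :: "'p::prime_card fpoly fps"
  assumes "power_weighted j k F" and "power_weighted j' k' G"
  shows "power_weighted (j + j') (k + k') (F * G)"
  unfolding power_weighted_def
proof (intro allI impI)
  fix e assume "fps_nth (F * G) e \<noteq> 0"
  then obtain s where s: "s \<le> e" "fps_nth F s * fps_nth G (e - s) \<noteq> 0"
    unfolding fps_mult_nth by (metis (no_types, lifting) atLeastAtMost_iff sum.neutral)
  then have "fps_nth F s \<noteq> 0" "fps_nth G (e - s) \<noteq> 0" by auto
  with assms have "sum_of_powers CARD('p) (k + k')
      ((CARD('p) - 1) * s + j + ((CARD('p) - 1) * (e - s) + j'))"
    by (intro sum_of_powers_add) (auto simp: power_weighted_def)
  moreover have "(CARD('p) - 1) * e = (CARD('p) - 1) * s + (CARD('p) - 1) * (e - s)"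
    using s(1) by (simp flip: distrib_left)
  ultimately show "sum_of_powers CARD('p) (k + k') ((CARD('p) - 1) * e + (j + j'))"
    by (simp add: ac_simps)
qed

lemma power_weighted_scale: "power_weighted j k F \<Longrightarrow> power_weighted j k (fps_const c * F)"
  using power_weighted_mult [OF power_weighted_const] by fastforce

lemma power_weighted_power:
  "power_weighted j k F \<Longrightarrow> power_weighted (r * j) (r * k) (F ^ r)"
  using power_weighted_const [of 1] by (induction r) (auto intro: power_weighted_mult)

lemma power_weighted_prod:
  "(\<And>i. i \<in> A \<Longrightarrow> power_weighted j k (h i)) \<Longrightarrow>
     power_weighted (card A * j) (card A * k) (prod h A)"
  using power_weighted_const [of 1]
  by (induction A rule: infinite_finite_induct) (auto intro: power_weighted_mult)

lemma power_weighted_hat_total_X: "power_weighted 1 1 (hat_total (X i :: 'p::prime_card fpoly))"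
  unfolding power_weighted_def
proof (intro allI impI)
  fix e
  let ?q = "CARD('p)"
  assume nz: "fps_nth (hat_total (X i :: 'p fpoly)) e \<noteq> 0"
  have "e < rep_num ?q (Suc e)"
    using rep_num_ge [OF prime_card_ge_2 [where 'p = 'p], of "Suc e"] by simp
  then have "fps_nth (hat_total (X i :: 'p fpoly)) e
      = (\<Sum>k<Suc e. fps_nth (fps_const (X i ^ ?q ^ k) * fps_X ^ rep_num ?q k) e)"
    by (subst hat_total_X_expansion [of i "Suc e"])
      (simp add: fps_sum_nth fps_X_power_mult_nth del: sum.lessThan_Suc)
  with nz obtain k where "fps_nth (fps_const (X i ^ ?q ^ k :: 'p fpoly) * fps_X ^ rep_num ?q k) e \<noteq> 0"
    by (metis (no_types, lifting) sum.neutral)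
  then have "e = rep_num ?q k"
    by (auto simp: fps_X_power_nth split: if_splits)
  then show "sum_of_powers ?q 1 ((?q - 1) * e + 1)"
    using rep_num_closed_form [OF prime_card_ge_2 [where 'p = 'p], of k] sum_of_powers_power
    by metis
qed

text \<open>
  By \<open>t S\<^sup>q = S - x\<close> the coefficients of \<open>S\<^sup>q\<close> are those of \<open>S\<close>, shifted. So \<open>S\<^sup>q\<close> counts as one
  power of \<open>q\<close> although it has \<open>q\<close> factors, and this deficiency drives the elimination below.
\<close>

lemma power_weighted_frobenius_hat_total_X:
  "power_weighted CARD('p) 1 (hat_total (X i :: 'p::prime_card fpoly) ^ CARD('p))"
  unfolding power_weighted_def
proof (intro allI impI)
  fix e
  let ?q = "CARD('p)"
  assume nz: "fps_nth (hat_total (X i :: 'p fpoly) ^ ?q) e \<noteq> 0"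
  have "fps_nth (hat_total (X i :: 'p fpoly)) (Suc e) = fps_nth (hat_total (X i) ^ ?q) e"
    by (subst hat_total_X_fixpoint) simp
  with nz have "sum_of_powers ?q 1 ((?q - 1) * Suc e + 1)"
    using power_weighted_hat_total_X [of i, where 'p = 'p] unfolding power_weighted_def by metis
  moreover have "(?q - 1) * Suc e + 1 = (?q - 1) * e + ?q"
    using prime_card_ge_2 [where 'p = 'p] by simp
  ultimately show "sum_of_powers ?q 1 ((?q - 1) * e + ?q)" by (simp only:)
qed


section \<open>Cofactors of the Moore matrix\<close>

text \<open>
  \<open>C\<close> consists of the cofactors of the last row: pairing them with row \<open>k\<close> computes the determinant
  with its last row replaced by row \<open>k\<close>.
\<close>

lemma moore_cofactors:
  "\<exists>C :: nat \<Rightarrow> 'p::prime_card fpoly. C m = w m \<and>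
     (\<forall>k\<le>m. (\<Sum>i\<le>m. C i * X (Suc i) ^ (CARD('p) ^ k)) = (if k = m then w (Suc m) else 0))"
proof -
  define A :: "'p fpoly mat" where
    "A = mat (Suc m) (Suc m) (\<lambda>(i, j). X (Suc j) ^ (CARD('p) ^ i))"
  have A: "A \<in> carrier_mat (Suc m) (Suc m)" by (simp add: A_def)
  have "mat_delete A m m = mat m m (\<lambda>(i, j). X (Suc j) ^ (CARD('p) ^ i))"
    by (rule eq_matI) (auto simp: A_def mat_delete_def)
  then have last: "cofactor A m m = w m"
    by (simp add: cofactor_def w_def)
  have "(\<Sum>i\<le>m. cofactor A m i * X (Suc i) ^ (CARD('p) ^ k)) = (if k = m then w (Suc m) else 0)"
    if k: "k \<le> m" for k
  proof -
    have "(\<Sum>i\<le>m. cofactor A m i * X (Suc i) ^ (CARD('p) ^ k)) = (A * adj_mat A) $$ (k, m)"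
      using k by (auto simp: A_def adj_mat_def scalar_prod_def atLeast0LessThan
          lessThan_Suc_atMost mult.commute simp del: sum.lessThan_Suc intro!: sum.cong)
    also have "\<dots> = (if k = m then w (Suc m) else 0)"
      using k by (simp add: adj_mat(2) [OF A]) (simp add: A_def w_def)
    finally show ?thesis .
  qed
  with last show ?thesis by (intro exI [of _ "cofactor A m"]) blast
qed

text \<open>
  The \<open>m!\<close> monomials of the Leibniz expansion are distinct, since the exponents \<open>q\<^sup>i\<close> are. So the
  diagonal monomial has coefficient \<open>1\<close>.
\<close>

lemma w_nonzero: "(w m :: 'p::prime_card fpoly) \<noteq> 0"
proof
  let ?q = "CARD('p)"
  define e :: "(nat \<Rightarrow> nat) \<Rightarrow> (nat \<Rightarrow>\<^sub>0 nat)" where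
    "e \<pi> = (\<Sum>i<m. Poly_Mapping.single (Suc (\<pi> i)) (?q ^ i))" for \<pi>
  have lookup_e: "Poly_Mapping.lookup (e \<pi>) (Suc (\<pi> i)) = ?q ^ i"
    if "\<pi> permutes {..<m}" "i < m" for \<pi> i
  proof -
    have "Poly_Mapping.lookup (e \<pi>) (Suc (\<pi> i)) = (\<Sum>j<m. if j = i then ?q ^ i else 0)"
      unfolding e_def lookup_sum
      by (rule sum.cong) (use permutes_inj [OF that(1)] in \<open>auto simp: lookup_single inj_eq\<close>)
    then show ?thesis using that by simp
  qed
  have e_inj: "\<pi> = id" if \<pi>: "\<pi> permutes {..<m}" and eq: "e \<pi> = e id" for \<pi>
  proof
    fix i show "\<pi> i = id i"
    proof (cases "i < m")
      case True
      with \<pi> have "\<pi> i < m" by (metis lessThan_iff permutes_in_image)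
      then have "?q ^ i = ?q ^ \<pi> i"
        using lookup_e [OF \<pi> True] lookup_e [of id "\<pi> i"] by (simp add: eq permutes_id)
      then show ?thesis using prime_card_ge_2 [where 'p = 'p] by simp
    qed (use \<pi> in \<open>simp add: permutes_def\<close>)
  qed
  have "w m = (\<Sum>\<pi> | \<pi> permutes {..<m}. signof \<pi> * (\<Prod>i<m. X (Suc (\<pi> i)) ^ (?q ^ i)) :: 'p fpoly)"
    unfolding w_def det_def
    by (auto simp: atLeast0LessThan permutes_in_image intro!: sum.cong prod.cong)
  also have "\<dots> = (\<Sum>\<pi> | \<pi> permutes {..<m}. Poly_Mapping.single (e \<pi>) (signof \<pi>))"
    by (intro sum.cong) (auto simp: X_power prod_single e_def sign_def single_uminus)
  finally have "Poly_Mapping.lookup (w m :: 'p fpoly) (e id)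
      = (\<Sum>\<pi> | \<pi> permutes {..<m}. if \<pi> = id then 1 else 0)"
    by (auto simp: lookup_sum lookup_single when_def dest: e_inj intro!: sum.cong)
  also have "\<dots> = 1"
    by (simp add: finite_permutations permutes_id)
  also assume "w m = (0 :: 'p fpoly)"
  finally show False by simp
qed

lemma fps_const_sum: "fps_const (sum h A) = (\<Sum>i\<in>A. fps_const (h i))"
  by (rule fps_ext) (simp add: fps_sum_nth)

text \<open>
  One elimination step, on series: the cofactors remove every term of order below \<open>p\<^sub>m\<close>, and the term
  after \<open>t\<^bsup>p\<^sub>m\<^esup>\<close> that can survive has order \<open>p\<^bsub>m+1\<^esub> = p\<^sub>m + q\<^sup>m\<close>.
\<close>

lemma cofactor_combination:
  "\<exists>(C :: nat \<Rightarrow> 'p::prime_card fpoly) Y. C m = w m \<and>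
     (\<Sum>i\<le>m. fps_const (C i) * hat_total (X (Suc i)))
       = fps_X ^ rep_num CARD('p) m * (fps_const (w (Suc m)) + fps_X ^ (CARD('p) ^ m) * Y)"
proof -
  let ?q = "CARD('p)" and ?S = "\<lambda>i. hat_total (X (Suc i) :: 'p fpoly)"
  obtain C :: "nat \<Rightarrow> 'p fpoly" where Cm: "C m = w m"
    and C: "\<And>k. k \<le> m \<Longrightarrow>
      (\<Sum>i\<le>m. C i * X (Suc i) ^ (?q ^ k)) = (if k = m then w (Suc m) else 0)"
    using moore_cofactors [of m, where 'p = 'p] by blast
  define Y where "Y = (\<Sum>i\<le>m. fps_const (C i) * ?S i ^ (?q ^ Suc m))"
  have "(\<Sum>i\<le>m. fps_const (C i) * ?S i)
      = (\<Sum>i\<le>m. \<Sum>k\<le>m. fps_const (C i * X (Suc i) ^ ?q ^ k) * fps_X ^ rep_num ?q k)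
        + fps_X ^ rep_num ?q (Suc m) * Y"
    unfolding Y_def
    by (subst hat_total_X_expansion [where K = "Suc m"])
      (simp add: distrib_left sum.distrib sum_distrib_left lessThan_Suc_atMost mult.assoc
        mult.left_commute flip: fps_const_mult del: fps_const_mult sum.lessThan_Suc)
  also have "(\<Sum>i\<le>m. \<Sum>k\<le>m. fps_const (C i * X (Suc i) ^ ?q ^ k) * fps_X ^ rep_num ?q k)
      = (\<Sum>k\<le>m. fps_const (\<Sum>i\<le>m. C i * X (Suc i) ^ ?q ^ k) * fps_X ^ rep_num ?q k)"
    by (subst sum.swap) (simp add: fps_const_sum sum_distrib_right)
  also have "\<dots> = (\<Sum>k\<le>m. if k = m then fps_const (w (Suc m)) * fps_X ^ rep_num ?q m else 0)"
    by (rule sum.cong) (auto simp: C)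
  finally show ?thesis
    using Cm by (intro exI [of _ C] exI [of _ Y])
      (simp add: rep_num_Suc [OF prime_card_ge_2] power_add algebra_simps)
qed

section \<open>Elimination under the coefficient\<close>

text \<open>
  With \<open>B = \<Sum>\<^sub>i C\<^sub>i S\<^sub>i\<close> and \<open>T = w m S\<^sub>n\<close>, where \<open>n = m + 1\<close>, the difference \<open>B\<^sup>b - T\<^sup>b\<close> is divisible
  by \<open>B - T\<close>, a combination of \<open>S\<^sub>1, \<dots>, S\<^sub>m\<close>. After multiplication by \<open>Q\<close> each of its terms contains
  some \<open>S\<^sub>i\<^sup>q\<close>, and so does not reach the exponent in question by \<open>sum_of_powers_min_length\<close>. Hence
  \<open>Q T\<^sup>b\<close> and \<open>Q B\<^sup>b\<close> have the same coefficient there, and that of \<open>Q B\<^sup>b\<close> is read off from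
  \<open>cofactor_combination\<close>.
\<close>

lemma coefficient_elimination:
  fixes b m :: nat
  defines "q \<equiv> CARD('p::prime_card)"
  defines "Q \<equiv> (\<Prod>i<m. hat_total (X (Suc i) :: 'p fpoly)) ^ (q - 1)"
  assumes b: "b < q"
  shows "w m ^ b * fps_nth (Q * hat_total (X (Suc m)) ^ b) ((b + 1) * rep_num q m - m)
    = w (Suc m) ^ b * fps_nth Q (rep_num q m - m)"
proof -
  have q2: "q \<ge> 2" unfolding q_def by (rule prime_card_ge_2)
  let ?S = "\<lambda>i. hat_total (X (Suc i) :: 'p fpoly)"
  let ?E = "(b + 1) * rep_num q m - m"
  obtain C :: "nat \<Rightarrow> 'p fpoly" and Y where Cm: "C m = w m"
    and C: "(\<Sum>i\<le>m. fps_const (C i) * ?S i)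
      = fps_X ^ rep_num q m * (fps_const (w (Suc m)) + fps_X ^ (q ^ m) * Y)"
    using cofactor_combination [of m, where 'p = 'p] unfolding q_def by blast
  define B where "B = (\<Sum>i\<le>m. fps_const (C i) * ?S i)"
  define T where "T = fps_const (w m) * ?S m"
  define G where "G = (\<Sum>j<b. T ^ (b - Suc j) * B ^ j)"
  have B_T: "B - T = (\<Sum>i<m. fps_const (C i) * ?S i)"
    by (simp add: B_def T_def Cm flip: lessThan_Suc_atMost)
  have weight_T: "power_weighted 1 1 T"
    unfolding T_def by (intro power_weighted_scale power_weighted_hat_total_X)
  have weight_B: "power_weighted 1 1 B"
    unfolding B_def by (intro power_weighted_sum power_weighted_scale power_weighted_hat_total_X)
  have weight_G: "power_weighted (b - 1) (b - 1) G"
    unfolding G_def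
  proof (rule power_weighted_sum)
    fix j assume "j \<in> {..<b}"
    then have "b - 1 = (b - Suc j) * 1 + j * 1" by simp
    then show "power_weighted (b - 1) (b - 1) (T ^ (b - Suc j) * B ^ j)"
      using power_weighted_mult [OF power_weighted_power [OF weight_T, of "b - Suc j"]
          power_weighted_power [OF weight_B, of j]] by metis
  qed
  have weight_SQ: "power_weighted (m * (q - 1) + 1) ((m - 1) * (q - 1) + 1) (?S i * Q)"
    if "i < m" for i
  proof -
    have "Q = ?S i ^ (q - 1) * (\<Prod>j\<in>{..<m} - {i}. ?S j ^ (q - 1))"
      unfolding Q_def prod_power_distrib using that by (subst prod.remove [of _ i]) auto
    then have "?S i * Q = ?S i ^ q * (\<Prod>j\<in>{..<m} - {i}. ?S j ^ (q - 1))"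
      using q2 by (cases q) (simp_all add: mult.assoc)
    moreover have "power_weighted (card ({..<m} - {i}) * ((q - 1) * 1))
        (card ({..<m} - {i}) * ((q - 1) * 1)) (\<Prod>j\<in>{..<m} - {i}. ?S j ^ (q - 1))"
      by (intro power_weighted_prod power_weighted_power power_weighted_hat_total_X)
    then have "power_weighted ((m - 1) * (q - 1)) ((m - 1) * (q - 1))
        (\<Prod>j\<in>{..<m} - {i}. ?S j ^ (q - 1))"
      using that by simp
    then have "power_weighted (q + (m - 1) * (q - 1)) (1 + (m - 1) * (q - 1))
        (?S i ^ q * (\<Prod>j\<in>{..<m} - {i}. ?S j ^ (q - 1)))"
      unfolding q_def by (rule power_weighted_mult [OF power_weighted_frobenius_hat_total_X])
    moreover have "q + (m - 1) * (q - 1) = m * (q - 1) + 1"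
      using that q2 by (cases m) auto
    ultimately show ?thesis by simp
  qed
  \<comment> \<open>The weight counts \<open>q - 1\<close> powers of \<open>q\<close> fewer than the digit sum at \<open>?E\<close> requires.\<close>
  have "fps_nth (Q * B ^ b) ?E = fps_nth (Q * T ^ b) ?E"
  proof (rule ccontr)
    assume neq: "\<not> ?thesis"
    have "B ^ b - T ^ b = (\<Sum>i<m. fps_const (C i) * ?S i) * G"
      using power_diff_sumr2 [of B b T] by (simp add: B_T G_def)
    then have eq: "Q * B ^ b - Q * T ^ b = (\<Sum>i<m. fps_const (C i) * (?S i * Q)) * G"
      by (simp add: right_diff_distrib [symmetric] sum_distrib_left sum_distrib_right ac_simps)
    have "b \<noteq> 0" using neq by (cases b) auto
    have "m \<noteq> 0"
    proof
      assume "m = 0"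
      with eq have "Q * B ^ b = Q * T ^ b" by simp
      with neq show False by simp
    qed
    have "power_weighted (m * (q - 1) + 1 + (b - 1)) ((m - 1) * (q - 1) + 1 + (b - 1))
        (Q * B ^ b - Q * T ^ b)"
      unfolding eq by (intro power_weighted_mult weight_G power_weighted_sum power_weighted_scale
          weight_SQ) simp
    moreover have "fps_nth (Q * B ^ b - Q * T ^ b) ?E \<noteq> 0"
      using neq by simp
    ultimately have "sum_of_powers q ((m - 1) * (q - 1) + 1 + (b - 1))
        ((q - 1) * ?E + (m * (q - 1) + 1 + (b - 1)))"
      unfolding power_weighted_def q_def by blast
    moreover have "(q - 1) * ?E + (m * (q - 1) + 1 + (b - 1)) + 1 = (b + 1) * q ^ m"
    proof -
      have "m \<le> (b + 1) * rep_num q m"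
        by (rule order.trans [OF rep_num_ge [OF q2]]) simp
      then have "(q - 1) * (?E + m) = (b + 1) * ((q - 1) * rep_num q m)"
        by (simp only: le_add_diff_inverse2 mult.left_commute)
      then have "(q - 1) * ?E + m * (q - 1) = (b + 1) * ((q - 1) * rep_num q m)"
        by (simp only: distrib_left mult.commute [of m])
      moreover have "(b + 1) * ((q - 1) * rep_num q m) + (b + 1) = (b + 1) * q ^ m"
        by (simp flip: rep_num_closed_form [OF q2, of m] add: algebra_simps)
      ultimately show ?thesis using \<open>b \<noteq> 0\<close> by linarith
    qed
    ultimately have "m * (q - 1) + b \<le> (m - 1) * (q - 1) + 1 + (b - 1)"
      by (rule sum_of_powers_min_length [OF b])
    then show False
      using \<open>b \<noteq> 0\<close> \<open>m \<noteq> 0\<close> q2 by (cases m) auto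
  qed
  moreover have "Q * T ^ b = fps_const (w m ^ b) * (Q * ?S m ^ b)"
    by (simp add: T_def power_mult_distrib fps_const_power ac_simps)
  moreover have "fps_nth (Q * B ^ b) ?E = w (Suc m) ^ b * fps_nth Q (rep_num q m - m)"
  proof -
    let ?R = "fps_const (w (Suc m)) + fps_X ^ (q ^ m) * Y"
    define H where "H = (\<Sum>j<b. fps_const (w (Suc m)) ^ (b - Suc j) * ?R ^ j)"
    have "?R ^ b - fps_const (w (Suc m)) ^ b = fps_X ^ (q ^ m) * (Y * H)"
      using power_diff_sumr2 [of ?R b "fps_const (w (Suc m))"] by (simp add: H_def mult.assoc)
    then have R: "?R ^ b = fps_const (w (Suc m) ^ b) + fps_X ^ (q ^ m) * (Y * H)"
      by (simp add: fps_const_power algebra_simps)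
    have "Q * B ^ b = fps_X ^ (b * rep_num q m)
        * (fps_const (w (Suc m) ^ b) * Q + fps_X ^ (q ^ m) * (Y * H * Q))"
      unfolding B_def C power_mult_distrib R
      by (simp add: algebra_simps flip: power_mult)
    \<comment> \<open>The exponent left after division by \<open>t\<^bsup>b p\<^sub>m\<^esup>\<close>; it is below the order \<open>q\<^sup>m\<close> of the error term.\<close>
    moreover define d where "d = rep_num q m - m"
    moreover have "?E = b * rep_num q m + d"
      using rep_num_ge [OF q2, of m] by (simp add: d_def)
    moreover have "d < q ^ m"
      using rep_num_less_power [OF q2, of m] by (simp add: d_def)
    ultimately show ?thesis
      by (simp add: fps_X_power_mult_nth flip: d_def)
  qed
  ultimately show ?thesis by simp
qed

lemma coefficient_pred_card:
  fixes m :: nat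
  defines "q \<equiv> CARD('p::prime_card)"
  shows "fps_nth ((\<Prod>i<m. hat_total (X (Suc i) :: 'p fpoly)) ^ (q - 1)) (rep_num q m - m)
    = w m ^ (q - 1)"
proof (induction m)
  case 0
  show ?case by (simp add: w_0)
next
  case (Suc m)
  have q2: "q \<ge> 2" unfolding q_def by (rule prime_card_ge_2)
  let ?Q = "\<lambda>m. (\<Prod>i<m. hat_total (X (Suc i) :: 'p fpoly)) ^ (q - 1)"
  \<comment> \<open>For \<open>b = q - 1\<close> the last variable is raised to the same power as the others.\<close>
  have "rep_num q (Suc m) - Suc m = ((q - 1) + 1) * rep_num q m - m"
    using q2 by (simp add: rep_num_Suc' [OF q2])
  then have "w m ^ (q - 1) * fps_nth (?Q (Suc m)) (rep_num q (Suc m) - Suc m)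
      = w (Suc m) ^ (q - 1) * fps_nth (?Q m) (rep_num q m - m)"
    using coefficient_elimination [where 'p = 'p, of "q - 1" m] q2
    by (simp add: q_def power_mult_distrib)
  with Suc.IH show ?case by (simp add: w_nonzero)
qed

lemma hat_total_coefficient:
  fixes b m :: nat
  defines "q \<equiv> CARD('p::prime_card)"
  assumes b: "b < q"
  shows "fps_nth ((\<Prod>i<m. hat_total (X (Suc i) :: 'p fpoly)) ^ (q - 1) * hat_total (X (Suc m)) ^ b)
      ((b + 1) * rep_num q m - m)
    = w (Suc m) ^ b * w m ^ (q - b - 1)"
    (is "?c = _")
proof -
  have "w m ^ b * ?c = w (Suc m) ^ b * w m ^ (q - 1)"
    using coefficient_elimination [where 'p = 'p, of b m] b
      coefficient_pred_card [where 'p = 'p, of m] by (simp add: q_def)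
  also have "w m ^ (q - 1) = (w m ^ b * w m ^ (q - b - 1) :: 'p fpoly)"
    using b by (simp flip: power_add)
  finally show ?thesis by (simp add: w_nonzero mult.left_commute)
qed

theorem corollary4p3:
  fixes p n b :: nat
  assumes "CARD('p::prime_card) = p" and "odd p"
    and "n \<ge> 1" and "1 \<le> b" and "b \<le> p - 1"
  shows "steenrod_hat ((b + 1) * rep_num p (n - 1) - (n - 1))
           ((\<Prod>i=1..n-1. X i) ^ (p - 1) * X n ^ b)
         = (w n ^ b * w (n - 1) ^ (p - b - 1) :: 'p fpoly)"
proof -
  obtain m where n: "n = Suc m" using assms(3) by (cases n) auto
  have p: "p = CARD('p)" and b: "b < CARD('p)"
    using assms prime_card_ge_2 [where 'p = 'p] by auto
  have "(\<Prod>i=1..m. X i) = (\<Prod>i<m. X (Suc i) :: 'p fpoly)"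
    by (simp add: prod.atLeast1_atMost_eq)
  then have "steenrod_hat r ((\<Prod>i=1..m. X i) ^ (p - 1) * X n ^ b :: 'p fpoly)
      = fps_nth ((\<Prod>i<m. hat_total (X (Suc i))) ^ (p - 1) * hat_total (X (Suc m)) ^ b) r" for r
    by (simp add: n hat_total_def [of "_ * _"] flip: hat_total_mult hat_total_power hat_total_prod)
  then show ?thesis
    using hat_total_coefficient [OF b, of m] by (simp add: n p)
qed

end
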